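(* Let $P\in N_\mu$, i.e. $P$ is a binary cubic such that $\mu(P)$ is nonzero nilpotent, and let $\phi\in(k^2)^*$ be a square factor of $P$ (a nonzero linear form with $\phi^2\mid P$). (a) $\mu^{-1}(\mu(P))=\{P+a\Psi(P):a\in k\}\cup\{-P+b\Psi(P):b\in k\}$. (b) $\mu^{-1}(\mu(P))=\{P+a\phi^3:a\in k\}\cup\{-P+b\phi^3:b\in k\}$. (c) The two affine lines in (a) are disjoint, and the two affine lines in (b) are disjoint.
   Context: $k$ is a field of characteristic different from $2$ and $3$; $x,y$ is the standard coordinate basis of $(k^2)^*$; $S^3((k^2)^* )=\{ax^3+3bx^2y+3cxy^2+dy^3: a,b,c,d\in k\}$ is the space of binary cubics. The moment map $\mu:S^3((k^2)^* )\to\mathfrak{sl}(2,k)$ is $$\mu(ax^3+3bx^2y+3cxy^2+dy^3)=\begin{pmatrix} ad-bc & 2(bd-c^2)\\ 2(b^2-ac) & -(ad-bc)\end{pmatrix}.$$ $\mathfrak{sl}(2,k)$ acts on $(k^2)^*$ by $\begin{pmatrix}\alpha&\beta\\ \gamma&-\alpha\end{pmatrix}\cdot x=-\alpha x-\beta y$, $\begin{pmatrix}\alpha&\beta\\ \gamma&-\alpha\end{pmatrix}\cdot y=-\gamma x+\alpha y$, and on $S^3((k^2)^* )$ by derivations; $\Psi(P)=\mu(P)\cdot P$. Every $P\in N_\mu$ has a square factor $\phi$, unique up to scalar. *)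

theory Defs
  imports "HOL-Analysis.Analysis" "HOL-Computational_Algebra.Polynomial"
begin

(* The symmetric algebra of the dual of k^2 is modelled as k[x][y]: the outer indeterminate is y, the coefficients
   are polynomials in x, and the scalar c is the polynomial [:[:c:]:]. *)

abbreviation varX :: "'a::field poly poly"
  where "varX \<equiv> [:[:0, 1:]:]"

abbreviation varY :: "'a::field poly poly"
  where "varY \<equiv> [:0, 1:]"

definition scal :: "'a::field \<Rightarrow> 'a poly poly \<Rightarrow> 'a poly poly"
  where "scal c P = smult [:c:] P"

definition linear_forms :: "'a::field poly poly set"
  where "linear_forms = {scal p varX + scal q varY | p q. True}"

definition cubic :: "'a::field \<Rightarrow> 'a \<Rightarrow> 'a \<Rightarrow> 'a \<Rightarrow> 'a poly poly"
  where "cubic a b c d =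
    scal a (varX ^ 3) + scal (3 * b) (varX\<^sup>2 * varY)
      + scal (3 * c) (varX * varY\<^sup>2) + scal d (varY ^ 3)"

definition binary_cubics :: "'a::field poly poly set"
  where "binary_cubics = {cubic a b c d | a b c d. True}"

(* Coefficient of x^i y^j. *)
definition xy_coeff :: "'a::field poly poly \<Rightarrow> nat \<Rightarrow> nat \<Rightarrow> 'a"
  where "xy_coeff P i j = coeff (coeff P j) i"

(* The parameters b, c of a cubic are its middle coefficients divided by 3;
   see mu_cubic. *)
definition mu :: "'a::field poly poly \<Rightarrow> 'a ^ 2 ^ 2"
  where "mu P =
    (let a = xy_coeff P 3 0; b = xy_coeff P 2 1 / 3;
         c = xy_coeff P 1 2 / 3; d = xy_coeff P 0 3
     in vector [vector [a * d - b * c, 2 * (b * d - c\<^sup>2)],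
                vector [2 * (b\<^sup>2 - a * c), - (a * d - b * c)]])"

definition sl2 :: "('a::field ^ 2 ^ 2) set"
  where "sl2 = {A. trace A = 0}"

(* The power A^n is an iterated matrix product: the type class power on vectors
   is not available for (**). *)
definition nilpotent_matrix :: "'a::field ^ 'n ^ 'n \<Rightarrow> bool"
  where "nilpotent_matrix A \<longleftrightarrow> (\<exists>n. (((**) A) ^^ n) (mat 1) = 0)"

definition deriv_x :: "'a::field poly poly \<Rightarrow> 'a poly poly"
  where "deriv_x P = map_poly pderiv P"

definition deriv_y :: "'a::field poly poly \<Rightarrow> 'a poly poly"
  where "deriv_y P = pderiv P"

(* The unique k-linear derivation of k[x,y] with the prescribed values on x and y
   (meaningful for A in sl2, where the lower right entry of A is -alpha). *)
definition sl2_act :: "'a::field ^ 2 ^ 2 \<Rightarrow> 'a poly poly \<Rightarrow> 'a poly poly"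
  where "sl2_act A P =
    (let \<alpha> = A $ 1 $ 1; \<beta> = A $ 1 $ 2; \<gamma> = A $ 2 $ 1
     in (scal (- \<alpha>) varX + scal (- \<beta>) varY) * deriv_x P
        + (scal (- \<gamma>) varX + scal \<alpha> varY) * deriv_y P)"

definition Psi :: "'a::field poly poly \<Rightarrow> 'a poly poly"
  where "Psi P = sl2_act (mu P) P"

definition N_mu :: "'a::field poly poly set"
  where "N_mu = {P \<in> binary_cubics. mu P \<noteq> 0 \<and> nilpotent_matrix (mu P)}"

definition mu_fibre :: "'a::field ^ 2 ^ 2 \<Rightarrow> 'a poly poly set"
  where "mu_fibre A = {Q \<in> binary_cubics. mu Q = A}"

definition affine_line :: "'a::field poly poly \<Rightarrow> 'a poly poly \<Rightarrow> 'a poly poly set"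
  where "affine_line P V = {P + scal a V | a. True}"

definition square_factor :: "'a::field poly poly \<Rightarrow> 'a poly poly \<Rightarrow> bool"
  where "square_factor \<phi> P \<longleftrightarrow> \<phi> \<in> linear_forms \<and> \<phi> \<noteq> 0 \<and> \<phi>\<^sup>2 dvd P"

lemma xy_coeff_cubic:
  "xy_coeff (cubic a b c d) 3 0 = a" "xy_coeff (cubic a b c d) 2 1 = 3 * b"
  "xy_coeff (cubic a b c d) 1 2 = 3 * c" "xy_coeff (cubic a b c d) 0 3 = d"
  by (simp_all add: xy_coeff_def cubic_def scal_def power2_eq_square power3_eq_cube
      numeral_2_eq_2 numeral_3_eq_3)

lemma mu_cubic:
  fixes a b c d :: "'a::field"
  assumes "(3::'a) \<noteq> 0"
  shows "mu (cubic a b c d) =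
    vector [vector [a * d - b * c, 2 * (b * d - c\<^sup>2)],
            vector [2 * (b\<^sup>2 - a * c), - (a * d - b * c)]]"
  using assms by (simp only: mu_def xy_coeff_cubic Let_def) simp

lemma mu_in_sl2: "mu P \<in> sl2"
  by (simp add: mu_def sl2_def trace_def sum_2 Let_def)

lemma deriv_x_mult:
  fixes P Q :: "'a::field poly poly"
  shows "deriv_x (P * Q) = deriv_x P * Q + P * deriv_x Q"
proof (rule poly_eqI)
  fix n
  have pd: "pderiv (\<Sum>i\<in>A. f i) = (\<Sum>i\<in>A. pderiv (f i))" for f :: "nat \<Rightarrow> 'a poly" and A
    by (induction A rule: infinite_finite_induct) (simp_all add: pderiv_add)
  have pm: "pderiv (p * q) = pderiv p * q + p * pderiv q" for p q :: "'a poly"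
    by (simp add: pderiv_mult algebra_simps)
  show "coeff (deriv_x (P * Q)) n = coeff (deriv_x P * Q + P * deriv_x Q) n"
    by (simp add: deriv_x_def coeff_map_poly coeff_mult pd pm sum.distrib)
qed

lemma deriv_x_add: "deriv_x (P + Q) = deriv_x P + deriv_x Q"
  by (rule poly_eqI) (simp add: deriv_x_def coeff_map_poly pderiv_add)

lemma sl2_act_derivation:
  "sl2_act A (P + Q) = sl2_act A P + sl2_act A Q"
  "sl2_act A (P * Q) = sl2_act A P * Q + P * sl2_act A Q"
  "sl2_act A [:[:c:]:] = 0"
  by (simp_all add: sl2_act_def Let_def deriv_x_add deriv_x_mult deriv_y_def pderiv_add
      pderiv_mult algebra_simps) (simp add: deriv_x_def map_poly_pCons pderiv_pCons)

lemma sl2_act_vars: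
  fixes A :: "'a::field ^ 2 ^ 2"
  shows
  "sl2_act A varX = scal (- (A $ 1 $ 1)) varX + scal (- (A $ 1 $ 2)) varY"
  "sl2_act A varY = scal (- (A $ 2 $ 1)) varX + scal (A $ 1 $ 1) varY"
proof -
  have "smult [:1:] Q = Q" for Q :: "'a poly poly"
    by (metis one_pCons smult_1_left)
  then show
    "sl2_act A varX = scal (- (A $ 1 $ 1)) varX + scal (- (A $ 1 $ 2)) varY"
    "sl2_act A varY = scal (- (A $ 2 $ 1)) varX + scal (A $ 1 $ 1) varY"
    by (simp_all add: sl2_act_def Let_def deriv_x_def deriv_y_def map_poly_pCons pderiv_pCons)
qed

end

theory Submission
  imports Defs
begin

text \<open>Write \<open>P = \<phi>\<^sup>2 \<ell>\<close>, where \<open>\<phi> = p x + q y\<close> and \<open>\<ell> = r x + s y\<close>, and let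
  \<open>D = p s - q r\<close>. Up to the factor \<open>D\<^sup>2\<close>, the moment map of \<open>P\<close> depends on \<open>\<phi>\<close> only:
  \<open>\<mu>(P) = - 2/9 D\<^sup>2 M\<close>, where \<open>M\<close> is the nilpotent matrix with rows \<open>(p q, q\<^sup>2)\<close> and
  \<open>(- p\<^sup>2, - p q)\<close> (lemma \<open>mu_sq_lin_times_lin\<close>). In particular \<open>\<mu>(P) \<noteq> 0\<close> says that \<open>D \<noteq> 0\<close>.

  The fibre is found by linear algebra. The entries of \<open>\<mu>\<close> at the cubic with parameters
  \<open>a, b, c, d\<close> are, up to constants, the \<open>2 \<times> 2\<close> minors of the matrix with rows \<open>(a, b, c)\<close> and
  \<open>(b, c, d)\<close>, so both rows are orthogonal to the vector of these minors. On the fibre of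
  \<open>\<mu>(P)\<close> this vector is a nonzero multiple of \<open>(q\<^sup>2, - 2 p q, p\<^sup>2)\<close>, and orthogonality to the latter
  means that both partial derivatives of the cubic vanish at the zero \<open>(q, - p)\<close> of \<open>\<phi>\<close>, that is, that
  \<open>\<phi>\<^sup>2\<close> divides the cubic (lemmas \<open>cubic_divisible_by_sq_lin\<close> and
  \<open>cubic_eq_sq_lin_times_lin\<close>). Hence every element of the fibre is \<open>\<phi>\<^sup>2 \<ell>'\<close> for a linear form
  \<open>\<ell>'\<close>, and the factor \<open>D\<^sup>2\<close> gives \<open>D' = \<plusminus>D\<close> (lemma \<open>mem_mu_fibre_iff\<close>). Since \<open>D'\<close> determines
  \<open>\<ell>'\<close> up to multiples of \<open>\<phi>\<close>, the fibre consists of the lines \<open>\<phi>\<^sup>2 (\<plusminus>\<ell> + a \<phi>)\<close>, which are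
  disjoint because \<open>D \<noteq> - D\<close>.

  Finally, \<open>\<mu>(P)\<close> annihilates \<open>\<phi>\<close> and maps \<open>\<ell>\<close> to \<open>- 2/9 D\<^sup>3 \<phi>\<close>, so
  \<open>\<Psi>(P) = - 2/9 D\<^sup>3 \<phi>\<^sup>3\<close> is a nonzero multiple of \<open>\<phi>\<^sup>3\<close> (lemma \<open>Psi_sq_lin_times_lin\<close>), and the
  directions \<open>\<Psi>(P)\<close> and \<open>\<phi>\<^sup>3\<close> span the same lines.\<close>

section \<open>Binary cubics with a square factor\<close>

definition lin :: "'a::field \<Rightarrow> 'a \<Rightarrow> 'a poly poly"
  where "lin p q = scal p varX + scal q varY"

lemma lin_pCons: "lin p q = [:[:0, p:], [:q:]:]"
  by (simp add: lin_def scal_def)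

lemma cubic_pCons:
  "cubic a b c d = [:[:0, 0, 0, a:], [:0, 0, 3 * b:], [:0, 3 * c:], [:d:]:]"
  by (simp add: cubic_def scal_def power2_eq_square power3_eq_cube)

lemma of_nat_prime_neq_0:
  assumes "prime n" and "CHAR('a::field) \<noteq> n"
  shows "of_nat n \<noteq> (0::'a)"
proof
  assume "of_nat n = (0::'a)"
  then have "CHAR('a) dvd n" by (simp only: of_nat_eq_0_iff_char_dvd)
  then show False
    using assms CHAR_not_1' [where 'a='a] unfolding prime_nat_iff by auto
qed

lemma sq_lin_times_lin_eq_cubic:
  assumes "(3::'a::field) \<noteq> 0"
  shows "(lin p q)\<^sup>2 * lin r s =
    cubic (p\<^sup>2 * r) ((p\<^sup>2 * s + 2 * p * q * r) / 3) ((q\<^sup>2 * r + 2 * p * q * s) / 3) (q\<^sup>2 * (s::'a))"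
  using assms
  by (simp add: lin_pCons cubic_pCons power2_eq_square field_simps)

text \<open>The two hypotheses say that the partial derivatives of the cubic vanish at \<open>(q, - p)\<close>, so that
  the point is a double root. The factor \<open>r x + s y\<close> is read off from two adjacent coefficients at
  the end where the form \<open>p x + q y\<close> has a nonzero coefficient; the hypotheses then force the
  other two coefficients.\<close>
lemma cubic_eq_sq_lin_times_lin:
  fixes a b c d p q :: "'a::field"
  assumes "(3::'a) \<noteq> 0" and pq: "p \<noteq> 0 \<or> q \<noteq> 0"
    and "a * q\<^sup>2 - 2 * b * p * q + c * p\<^sup>2 = 0"
    and "b * q\<^sup>2 - 2 * c * p * q + d * p\<^sup>2 = 0"
  shows "\<exists>r s. cubic a b c d = (lin p q)\<^sup>2 * lin r s"
  using pq
proof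
  assume p: "p \<noteq> 0"
  define r where "r = a / p\<^sup>2"
  define s where "s = (3 * b * p - 2 * q * a) / p ^ 3"
  have a: "a = p\<^sup>2 * r" using p by (simp add: r_def)
  have "p ^ 3 * s = 3 * b * p - 2 * q * a" using p by (simp add: s_def)
  then have "p * (3 * b) = p * (p\<^sup>2 * s + 2 * p * q * r)"
    unfolding a by algebra
  then have b: "3 * b = p\<^sup>2 * s + 2 * p * q * r" using p by simp
  have "p\<^sup>2 * (3 * c) = p\<^sup>2 * (q\<^sup>2 * r + 2 * p * q * s)"
    using assms(3) a b by algebra
  then have c: "3 * c = q\<^sup>2 * r + 2 * p * q * s" using p by simp
  have "p\<^sup>2 * (3 * d) = p\<^sup>2 * (3 * (q\<^sup>2 * s))"
    using assms(4) b c by algebra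
  then have "d = q\<^sup>2 * s" using p assms(1) by simp
  then show ?thesis
    using a b c assms(1) sq_lin_times_lin_eq_cubic[of p q r s]
    by (metis nonzero_mult_div_cancel_left)
next
  assume q: "q \<noteq> 0"
  define s where "s = d / q\<^sup>2"
  define r where "r = (3 * c * q - 2 * p * d) / q ^ 3"
  have d: "d = q\<^sup>2 * s" using q by (simp add: s_def)
  have "q ^ 3 * r = 3 * c * q - 2 * p * d" using q by (simp add: r_def)
  then have "q * (3 * c) = q * (q\<^sup>2 * r + 2 * p * q * s)"
    unfolding d by algebra
  then have c: "3 * c = q\<^sup>2 * r + 2 * p * q * s" using q by simp
  have "q\<^sup>2 * (3 * b) = q\<^sup>2 * (p\<^sup>2 * s + 2 * p * q * r)"
    using assms(4) c d by algebra
  then have b: "3 * b = p\<^sup>2 * s + 2 * p * q * r" using q by simp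
  have "q\<^sup>2 * (3 * a) = q\<^sup>2 * (3 * (p\<^sup>2 * r))"
    using assms(3) b c by algebra
  then have "a = p\<^sup>2 * r" using q assms(1) by simp
  then show ?thesis
    using b c d assms(1) sq_lin_times_lin_eq_cubic[of p q r s]
    by (metis nonzero_mult_div_cancel_left)
qed

text \<open>The converse holds for an arbitrary cofactor: by the product rule, the square of a form divides
  a cubic only if the form divides its partial derivatives, which therefore vanish at the
  zero \<open>(q, - p)\<close> of the form.\<close>
lemma cubic_divisible_by_sq_lin:
  fixes a b c d p q :: "'a::field"
  assumes "(3::'a) \<noteq> 0" and "(lin p q)\<^sup>2 dvd cubic a b c d"
  shows "a * q\<^sup>2 - 2 * b * p * q + c * p\<^sup>2 = 0" (is "?X = 0")
    and "b * q\<^sup>2 - 2 * c * p * q + d * p\<^sup>2 = 0" (is "?Y = 0")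
proof -
  define ev where "ev F = poly (poly F [:- p:]) q" for F :: "'a poly poly"
  have ev_lin: "ev (lin p q) = 0" by (simp add: ev_def lin_pCons)
  obtain R where R: "cubic a b c d = lin p q * (lin p q * R)"
    using assms(2) by (metis dvdE mult.assoc power2_eq_square)
  have "ev (deriv_x (cubic a b c d)) = 0"
    using ev_lin unfolding R deriv_x_mult by (simp add: ev_def)
  moreover have "ev (deriv_x (cubic a b c d)) = 3 * ?X"
    by (simp add: ev_def deriv_x_def cubic_pCons map_poly_pCons pderiv_pCons
        power2_eq_square algebra_simps)
  ultimately show "?X = 0" using assms(1) by (metis mult_eq_0_iff)
  have "ev (deriv_y (cubic a b c d)) = 0"
    using ev_lin unfolding R deriv_y_def pderiv_mult by (simp add: ev_def)
  moreover have "ev (deriv_y (cubic a b c d)) = 3 * ?Y"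
    by (simp add: ev_def deriv_y_def cubic_pCons pderiv_pCons
        power2_eq_square algebra_simps)
  ultimately show "?Y = 0" using assms(1) by (metis mult_eq_0_iff)
qed

section \<open>The moment map and the fibres\<close>

text \<open>This explicit form carries the whole argument: the direction of the matrix depends only on the
  repeated factor, while its length is the square of the determinant of the two factors.\<close>
lemma mu_sq_lin_times_lin:
  fixes p q r s :: "'a::field"
  assumes "(3::'a) \<noteq> 0"
  defines "m \<equiv> - 2 * ((p * s - q * r) / 3)\<^sup>2"
  shows "mu ((lin p q)\<^sup>2 * lin r s) =
    vector [vector [m * (p * q), m * q\<^sup>2], vector [- m * p\<^sup>2, - (m * (p * q))]]"
proof -
  \<comment> \<open>The denominators are cleared by passing to \<open>9\<close> times each entry, since \<open>3 * K\<close>, \<open>3 * B\<close>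
    and \<open>3 * C\<close> are polynomials in \<open>p\<close>, \<open>q\<close>, \<open>r\<close>, \<open>s\<close>.\<close>
  define K B C where "K = (p * s - q * r) / 3" and "B = (p\<^sup>2 * s + 2 * p * q * r) / 3"
    and "C = (q\<^sup>2 * r + 2 * p * q * s) / 3"
  have m: "m = - 2 * K\<^sup>2" by (simp add: m_def K_def)
  have 3: "3 * K = p * s - q * r" "3 * B = p\<^sup>2 * s + 2 * p * q * r"
    "3 * C = q\<^sup>2 * r + 2 * p * q * s"
    using assms(1) by (simp_all add: K_def B_def C_def)
  have "3 * (3 * (p\<^sup>2 * r * (q\<^sup>2 * s) - B * C)) = 3 * (3 * (m * (p * q)))"
  proof -
    have "3 * (3 * (p\<^sup>2 * r * (q\<^sup>2 * s) - B * C)) = 9 * (p\<^sup>2 * r * (q\<^sup>2 * s)) - (3 * B) * (3 * C)"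
      by (simp add: power2_eq_square algebra_simps)
    also have "\<dots> = - 2 * (3 * K)\<^sup>2 * (p * q)"
      unfolding 3 by (simp add: power2_eq_square algebra_simps)
    also have "\<dots> = 3 * (3 * (m * (p * q)))"
      unfolding m by (simp add: power2_eq_square algebra_simps)
    finally show ?thesis .
  qed
  moreover have "3 * (3 * (2 * (B * (q\<^sup>2 * s) - C\<^sup>2))) = 3 * (3 * (m * q\<^sup>2))"
  proof -
    have "3 * (3 * (2 * (B * (q\<^sup>2 * s) - C\<^sup>2))) = 2 * (3 * (3 * B) * (q\<^sup>2 * s) - (3 * C)\<^sup>2)"
      by (simp add: power2_eq_square algebra_simps)
    also have "\<dots> = - 2 * (3 * K)\<^sup>2 * q\<^sup>2"
      unfolding 3 by (simp add: power2_eq_square algebra_simps)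
    also have "\<dots> = 3 * (3 * (m * q\<^sup>2))"
      unfolding m by (simp add: power2_eq_square algebra_simps)
    finally show ?thesis .
  qed
  moreover have "3 * (3 * (2 * (B\<^sup>2 - p\<^sup>2 * r * C))) = 3 * (3 * (- m * p\<^sup>2))"
  proof -
    have "3 * (3 * (2 * (B\<^sup>2 - p\<^sup>2 * r * C))) = 2 * ((3 * B)\<^sup>2 - 3 * (p\<^sup>2 * r) * (3 * C))"
      by (simp add: power2_eq_square algebra_simps)
    also have "\<dots> = 2 * (3 * K)\<^sup>2 * p\<^sup>2"
      unfolding 3 by (simp add: power2_eq_square algebra_simps)
    also have "\<dots> = 3 * (3 * (- m * p\<^sup>2))"
      unfolding m by (simp add: power2_eq_square algebra_simps)
    finally show ?thesis .
  qed
  ultimately have "p\<^sup>2 * r * (q\<^sup>2 * s) - B * C = m * (p * q)"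
    "2 * (B * (q\<^sup>2 * s) - C\<^sup>2) = m * q\<^sup>2"
    "2 * (B\<^sup>2 - p\<^sup>2 * r * C) = - m * p\<^sup>2"
    using assms(1) by (simp_all only: mult_cancel_left simp_thms)
  then show ?thesis
    unfolding sq_lin_times_lin_eq_cubic[OF assms(1)] mu_cubic[OF assms(1)]
    by (simp only: flip: B_def C_def)
qed

lemma sl2_act_lin:
  "sl2_act A (lin p q) =
    lin (- (p * A $ 1 $ 1) - q * A $ 2 $ 1) (q * A $ 1 $ 1 - p * A $ 1 $ 2)"
  by (simp add: lin_pCons sl2_act_def Let_def scal_def deriv_x_def deriv_y_def
      map_poly_pCons pderiv_pCons algebra_simps)

text \<open>As \<open>\<mu>\<close> of the cubic annihilates the repeated factor and maps the other factor into its span,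
  the derivation property leaves a multiple of a cube.\<close>
lemma Psi_sq_lin_times_lin:
  fixes p q r s :: "'a::field"
  assumes "(3::'a) \<noteq> 0"
  shows "Psi ((lin p q)\<^sup>2 * lin r s) = scal (- 2 * ((p * s - q * r) / 3)\<^sup>2 * (p * s - q * r)) (lin p q ^ 3)"
proof -
  define A where "A = mu ((lin p q)\<^sup>2 * lin r s)"
  define m where "m = - 2 * ((p * s - q * r) / 3)\<^sup>2"
  have A: "A $ 1 $ 1 = m * (p * q)" "A $ 1 $ 2 = m * q\<^sup>2" "A $ 2 $ 1 = - m * p\<^sup>2"
    unfolding A_def mu_sq_lin_times_lin[OF assms] m_def by simp_all
  have "sl2_act A (lin p q) = 0"
    unfolding sl2_act_lin A by (simp add: lin_pCons power2_eq_square algebra_simps)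
  moreover have "sl2_act A (lin r s) = scal (m * (p * s - q * r)) (lin p q)"
    unfolding sl2_act_lin A by (simp add: lin_pCons scal_def power2_eq_square algebra_simps)
  ultimately have "sl2_act A ((lin p q)\<^sup>2 * lin r s) =
      (lin p q)\<^sup>2 * scal (m * (p * s - q * r)) (lin p q)"
    by (simp add: power2_eq_square sl2_act_derivation)
  also have "\<dots> = scal (m * (p * s - q * r)) (lin p q ^ 3)"
    by (simp add: scal_def power2_eq_square power3_eq_cube)
  finally show ?thesis
    by (simp only: Psi_def A_def m_def)
qed

lemma affine_line_scal:
  assumes "t \<noteq> 0"
  shows "affine_line P (scal t V) = affine_line P V"
proof -
  have "range (\<lambda>a. P + scal a (scal t V)) = range ((\<lambda>a. P + scal a V) \<circ> (\<lambda>a. a * t))"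
    by (simp add: scal_def comp_def mult.commute)
  also have "\<dots> = range (\<lambda>a. P + scal a V)"
  proof -
    have "surj (\<lambda>a. a * t)"
      using assms by (intro surjI[of _ "\<lambda>a. a / t"]) simp
    then show ?thesis by (simp only: image_comp [symmetric])
  qed
  finally show ?thesis by (simp only: affine_line_def full_SetCompr_eq simp_thms)
qed

lemma affine_line_lin:
  "affine_line ((lin p q)\<^sup>2 * lin r s) (lin p q ^ 3)
    = {(lin p q)\<^sup>2 * lin (r + a * p) (s + a * q) | a. True}"
proof -
  have "(lin p q)\<^sup>2 * lin r s + scal a (lin p q ^ 3)
      = (lin p q)\<^sup>2 * (lin r s + scal a (lin p q))" for a
    by (simp add: scal_def power2_eq_square power3_eq_cube algebra_simps)
  moreover have "lin r s + scal a (lin p q) = lin (r + a * p) (s + a * q)" for a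
    by (simp add: lin_pCons scal_def)
  ultimately show ?thesis by (simp add: affine_line_def)
qed

text \<open>Equal determinants with a nonzero form \<open>p x + q y\<close> mean that the difference of the two other
  forms has determinant zero with it, hence is proportional to it.\<close>
lemma lin_congruent_if_bracket_eq:
  fixes p q r s r' s' :: "'a::field"
  assumes "p \<noteq> 0 \<or> q \<noteq> 0" and "p * s' - q * r' = p * s - q * r"
  shows "\<exists>a. r' = r + a * p \<and> s' = s + a * q"
proof (cases "p = 0")
  case True
  then have "r' = r \<and> s' = s + (s' - s) / q * q" using assms by auto
  with True show ?thesis by (metis add.right_neutral mult_zero_right)
next
  case False
  have "p * (s' - s) = (r' - r) * q" using assms(2) by algebra
  then have "s' = s + (r' - r) / p * q" using False by (simp add: field_simps)
  with False show ?thesis by (intro exI[of _ "(r' - r) / p"]) simp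
qed

text \<open>A nonzero value of \<open>\<mu>\<close> determines the repeated factor up to scalar: each cubic satisfies two
  linear relations whose coefficients are the entries of its own \<open>\<mu>\<close>, and these relations force
  the double root. Once the repeated factor is known, only the square of the determinant is left
  to compare.\<close>
lemma mem_mu_fibre_iff:
  fixes p q r s :: "'a::field"
  assumes "(2::'a) \<noteq> 0" and "(3::'a) \<noteq> 0" and pq: "p \<noteq> 0 \<or> q \<noteq> 0" and D: "p * s - q * r \<noteq> 0"
  shows "Q \<in> mu_fibre (mu ((lin p q)\<^sup>2 * lin r s)) \<longleftrightarrow>
    (\<exists>r' s'. Q = (lin p q)\<^sup>2 * lin r' s' \<and> (p * s' - q * r')\<^sup>2 = (p * s - q * r)\<^sup>2)"
proof
  assume "\<exists>r' s'. Q = (lin p q)\<^sup>2 * lin r' s' \<and> (p * s' - q * r')\<^sup>2 = (p * s - q * r)\<^sup>2"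
  then obtain r' s' where Q: "Q = (lin p q)\<^sup>2 * lin r' s'"
    and "(p * s' - q * r')\<^sup>2 = (p * s - q * r)\<^sup>2" by blast
  then have "mu Q = mu ((lin p q)\<^sup>2 * lin r s)"
    by (simp only: mu_sq_lin_times_lin[OF assms(2)] power_divide)
  moreover have "Q \<in> binary_cubics"
    unfolding Q sq_lin_times_lin_eq_cubic[OF assms(2)] binary_cubics_def by blast
  ultimately show "Q \<in> mu_fibre (mu ((lin p q)\<^sup>2 * lin r s))"
    by (simp add: mu_fibre_def)
next
  assume "Q \<in> mu_fibre (mu ((lin p q)\<^sup>2 * lin r s))"
  then have mu: "mu Q = mu ((lin p q)\<^sup>2 * lin r s)" and "Q \<in> binary_cubics"
    by (auto simp: mu_fibre_def)
  then obtain a b c d where Q: "Q = cubic a b c d" by (auto simp: binary_cubics_def)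
  define m where "m = - 2 * ((p * s - q * r) / 3)\<^sup>2"
  have m: "m \<noteq> 0" using assms(1,2) D by (simp add: m_def)
  have 1: "a * d - b * c = m * (p * q)" "2 * (b * d - c\<^sup>2) = m * q\<^sup>2" "2 * (b\<^sup>2 - a * c) = - m * p\<^sup>2"
    using mu unfolding Q mu_sq_lin_times_lin[OF assms(2)] m_def[symmetric] mu_cubic[OF assms(2)]
    by (simp_all add: vec_eq_iff forall_2)
  \<comment> \<open>The rows \<open>(a, b, c)\<close> and \<open>(b, c, d)\<close> are orthogonal to their own minors, which are, up to
    constants, the entries of the matrix.\<close>
  have "m * (a * q\<^sup>2 - 2 * b * p * q + c * p\<^sup>2) = 0"
    using 1 by algebra
  moreover have "m * (b * q\<^sup>2 - 2 * c * p * q + d * p\<^sup>2) = 0"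
    using 1 by algebra
  ultimately obtain r' s' where Q': "Q = (lin p q)\<^sup>2 * lin r' s'"
    using cubic_eq_sq_lin_times_lin[OF assms(2) pq] m unfolding Q by (metis mult_eq_0_iff)
  define m' where "m' = - 2 * ((p * s' - q * r') / 3)\<^sup>2"
  have "m' * q\<^sup>2 = m * q\<^sup>2" "m' * p\<^sup>2 = m * p\<^sup>2"
    using mu unfolding Q' mu_sq_lin_times_lin[OF assms(2)] m_def[symmetric] m'_def[symmetric]
    by (simp_all add: vec_eq_iff forall_2)
  then have "m' = m" using pq by auto
  then have "((p * s' - q * r') / 3)\<^sup>2 = ((p * s - q * r) / 3)\<^sup>2"
    using assms(1) by (simp only: m_def m'_def mult_cancel_left neg_equal_0_iff_equal simp_thms)
  then have "(3 * ((p * s' - q * r') / 3))\<^sup>2 = (3 * ((p * s - q * r) / 3))\<^sup>2"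
    by (simp only: power_mult_distrib)
  then have "(p * s' - q * r')\<^sup>2 = (p * s - q * r)\<^sup>2"
    using assms(2) by (simp only: times_divide_eq_right nonzero_mult_div_cancel_left not_False_eq_True)
  with Q' show "\<exists>r' s'. Q = (lin p q)\<^sup>2 * lin r' s' \<and> (p * s' - q * r')\<^sup>2 = (p * s - q * r)\<^sup>2"
    by blast
qed

theorem proposition3p17:
  fixes P \<phi> :: "'k::field poly poly"
  assumes "CHAR('k) \<noteq> 2" and "CHAR('k) \<noteq> 3"
    and "P \<in> N_mu"
    and "square_factor \<phi> P"
  shows "mu_fibre (mu P) = affine_line P (Psi P) \<union> affine_line (- P) (Psi P)
    \<and> mu_fibre (mu P) = affine_line P (\<phi> ^ 3) \<union> affine_line (- P) (\<phi> ^ 3)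
    \<and> affine_line P (Psi P) \<inter> affine_line (- P) (Psi P) = {}
    \<and> affine_line P (\<phi> ^ 3) \<inter> affine_line (- P) (\<phi> ^ 3) = {}"
proof -
  have two: "(2::'k) \<noteq> 0" and three: "(3::'k) \<noteq> 0"
    using of_nat_prime_neq_0[of 2, where 'a='k] of_nat_prime_neq_0[of 3, where 'a='k] assms(1,2)
    by simp_all
  obtain p q where \<phi>: "\<phi> = lin p q"
    using assms(4) by (auto simp: square_factor_def linear_forms_def lin_def)
  have "\<phi> \<noteq> 0" using assms(4) by (simp add: square_factor_def)
  then have pq: "p \<noteq> 0 \<or> q \<noteq> 0" by (auto simp: \<phi> lin_pCons)
  obtain a b c d where "P = cubic a b c d"
    using assms(3) by (auto simp: N_mu_def binary_cubics_def)
  moreover have "\<phi>\<^sup>2 dvd P" using assms(4) by (simp add: square_factor_def)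
  ultimately obtain r s where P: "P = (lin p q)\<^sup>2 * lin r s"
    using cubic_eq_sq_lin_times_lin[OF three pq] cubic_divisible_by_sq_lin[OF three]
    unfolding \<phi> by metis
  have D: "p * s - q * r \<noteq> 0"
  proof
    assume "p * s - q * r = 0"
    then have "mu P = 0"
      by (simp add: P mu_sq_lin_times_lin[OF three] vec_eq_iff forall_2)
    then show False using assms(3) by (simp add: N_mu_def)
  qed
  have "lin (- r) (- s) = - lin r s" by (simp add: lin_pCons)
  then have minus_P: "- P = (lin p q)\<^sup>2 * lin (- r) (- s)" by (simp add: P)
  have lines: "affine_line P (\<phi> ^ 3) = {(lin p q)\<^sup>2 * lin (r + a * p) (s + a * q) | a. True}"
    "affine_line (- P) (\<phi> ^ 3) = {(lin p q)\<^sup>2 * lin (- r + a * p) (- s + a * q) | a. True}"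
    unfolding \<phi> minus_P unfolding P by (rule affine_line_lin)+
  have fibre: "mu_fibre (mu P) = affine_line P (\<phi> ^ 3) \<union> affine_line (- P) (\<phi> ^ 3)"
  proof (rule set_eqI)
    fix Q
    have "(p * s' - q * r')\<^sup>2 = (p * s - q * r)\<^sup>2 \<longleftrightarrow>
        (\<exists>a. r' = r + a * p \<and> s' = s + a * q) \<or> (\<exists>a. r' = - r + a * p \<and> s' = - s + a * q)"
      (is "?L \<longleftrightarrow> ?R") for r' s'
    proof
      assume ?L
      then have "p * s' - q * r' = p * s - q * r \<or> p * s' - q * r' = p * (- s) - q * (- r)"
        by (simp add: power2_eq_iff)
      then show ?R using lin_congruent_if_bracket_eq[OF pq] by blast
    next
      assume ?R
      then show ?L by (elim disjE exE conjE) algebra+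
    qed
    then show "Q \<in> mu_fibre (mu P) \<longleftrightarrow> Q \<in> affine_line P (\<phi> ^ 3) \<union> affine_line (- P) (\<phi> ^ 3)"
      unfolding Un_iff lines unfolding P mem_mu_fibre_iff[OF two three pq D] by auto
  qed
  have disjoint: "affine_line P (\<phi> ^ 3) \<inter> affine_line (- P) (\<phi> ^ 3) = {}"
  proof (rule ccontr)
    assume "affine_line P (\<phi> ^ 3) \<inter> affine_line (- P) (\<phi> ^ 3) \<noteq> {}"
    then obtain a b where "\<phi>\<^sup>2 * lin (r + a * p) (s + a * q) = \<phi>\<^sup>2 * lin (- r + b * p) (- s + b * q)"
      unfolding lines unfolding \<phi> by blast
    then have "lin (r + a * p) (s + a * q) = lin (- r + b * p) (- s + b * q)"
      using \<open>\<phi> \<noteq> 0\<close> by simp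
    then have "r + a * p = - r + b * p" "s + a * q = - s + b * q"
      by (simp_all only: lin_pCons pCons_eq_iff)
    then have "2 * (p * s - q * r) = 0" by algebra
    then show False using two D by simp
  qed
  have "Psi P = scal (- 2 * ((p * s - q * r) / 3)\<^sup>2 * (p * s - q * r)) (\<phi> ^ 3)"
    unfolding P \<phi> by (rule Psi_sq_lin_times_lin[OF three])
  moreover have "- 2 * ((p * s - q * r) / 3)\<^sup>2 * (p * s - q * r) \<noteq> 0" using two three D by simp
  ultimately have "affine_line R (Psi P) = affine_line R (\<phi> ^ 3)" for R
    by (metis affine_line_scal)
  then show ?thesis using fibre disjoint by simp
qed

end
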